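(* Let $N\ge1$ and let $\theta_N$ be a number such that $\|f\|_0+\|\hat f\|_0\ge N-\theta_N$ holds for all non-zero $f\in\mathbb{C}^N$. Let $F$ denote the Fourier basis. Let $g\in\mathbb{C}^N$ have the following property: for each $\ell\in\mathbb{Z}_N$, the sequence $\tilde c_\ell=(\langle g,g_{p,\ell}\rangle)_{p\in\mathbb{Z}_N}$ obeys $$\theta_N+2k+1\le\|\tilde c_\ell\|_0\le\hat k$$ for some positive integers $k$ and $\hat k$ (independent of $\ell$). Then, for any subsets $A,B\subseteq\mathbb{Z}_N$ with $$|A|\ge\theta_N+(2k)^2-2k+2,\qquad|B|\ge\theta_N+\hat k+1,$$ the set $\{g_\lambda:\lambda\in A\times B\}$ allows $Fk$-sparse phase retrieval.
   Context: Vectors in $\mathbb{C}^N$ are indexed by $\mathbb{Z}_N=\mathbb{Z}/N\mathbb{Z}$; $\omega=e^{2\pi i/N}$. $\|f\|_0$ is the number of non-zero entries of $f$, and $\hat f(j)=\sum_{n=0}^{N-1}f(n)\omega^{-nj}$ is the discrete Fourier transform. The scalar product is $\langle x,y\rangle=\sum_{j\in\mathbb{Z}_N}\overline{x(j)}\,y(j)$. Translations and modulations are $(T_px)(n)=x(n-p)$ and $(M_\ell x)(n)=\omega^{\ell n}x(n)$. For $\lambda=(p,\ell)\in\mathbb{Z}_N^2$ put $g_\lambda=g_{p,\ell}=M_\ell T_pg$ (so in $A\times B$, the set $A$ contains translation parameters and $B$ modulation parameters). The Fourier basis $F$ is the $N\times N$ discrete Fourier matrix, normalized to be unitary, $F_{jn}=N^{-1/2}\omega^{-jn}$;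 a signal $x$ is $Fk$-sparse if $x=Fz$ for some $z\in\mathbb{C}^N$ with $\|z\|_0\le k$. With $\mathbb{T}=\{c\in\mathbb{C}:|c|=1\}$, a system $(g_\lambda)_{\lambda\in\Lambda}$ allows $Fk$-sparse phase retrieval if, whenever $x,y$ are $Fk$-sparse and satisfy $|\langle x,g_\lambda\rangle|=|\langle y,g_\lambda\rangle|$ for all $\lambda\in\Lambda$, there is $c\in\mathbb{T}$ with $x=cy$. *)

theory Defs
  imports Complex_Main "Jordan_Normal_Form.Matrix"
begin

text \<open>
  A signal of length \<open>N\<close> is a \<^typ>\<open>complex vec\<close> of dimension \<open>N\<close>. The index group of integers
  modulo \<open>N\<close> is represented by the residues \<open>{0..<N}\<close>, and the group operation is carried out
  modulo \<open>N\<close>.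
\<close>

definition root_of_unity :: "nat \<Rightarrow> complex" where
  "root_of_unity N = exp (2 * of_real pi * \<i> / of_nat N)"

definition norm0 :: "complex vec \<Rightarrow> nat" where
  "norm0 f = card {i. i < dim_vec f \<and> f $ i \<noteq> 0}"

definition dft :: "complex vec \<Rightarrow> complex vec" where
  "dft f = vec (dim_vec f)
     (\<lambda>j. \<Sum>n = 0..<dim_vec f. f $ n * root_of_unity (dim_vec f) powi (- int (n * j)))"

text \<open>
  Antilinear in the first argument, in contrast to the library's \<open>x \<bullet>c y\<close>, which conjugates the
  second one.
\<close>

definition inner_vec :: "complex vec \<Rightarrow> complex vec \<Rightarrow> complex" where
  "inner_vec x y = (\<Sum>j = 0..<dim_vec y. cnj (x $ j) * y $ j)"

definition translation :: "nat \<Rightarrow> complex vec \<Rightarrow> complex vec" where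
  "translation p x = vec (dim_vec x) (\<lambda>n. x $ nat ((int n - int p) mod int (dim_vec x)))"

definition modulation :: "nat \<Rightarrow> complex vec \<Rightarrow> complex vec" where
  "modulation l x = vec (dim_vec x) (\<lambda>n. root_of_unity (dim_vec x) ^ (l * n) * x $ n)"

definition tf_shift :: "complex vec \<Rightarrow> nat \<times> nat \<Rightarrow> complex vec" where
  "tf_shift g = (\<lambda>(p, l). modulation l (translation p g))"

definition fourier_basis :: "nat \<Rightarrow> complex mat" where
  "fourier_basis N =
     mat N N (\<lambda>(j, n). root_of_unity N powi (- int (j * n)) / of_real (sqrt (real N)))"

definition fourier_sparse :: "nat \<Rightarrow> nat \<Rightarrow> complex vec \<Rightarrow> bool" where
  "fourier_sparse N k x \<longleftrightarrow>
     (\<exists>z \<in> carrier_vec N. norm0 z \<le> k \<and> x = fourier_basis N *\<^sub>v z)"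

definition allows_fourier_sparse_phase_retrieval ::
    "nat \<Rightarrow> nat \<Rightarrow> 'i set \<Rightarrow> ('i \<Rightarrow> complex vec) \<Rightarrow> bool" where
  "allows_fourier_sparse_phase_retrieval N k \<Lambda> \<phi> \<longleftrightarrow>
     (\<forall>x y. fourier_sparse N k x \<longrightarrow> fourier_sparse N k y \<longrightarrow>
        (\<forall>i\<in>\<Lambda>. cmod (inner_vec x (\<phi> i)) = cmod (inner_vec y (\<phi> i))) \<longrightarrow>
        (\<exists>c. cmod c = 1 \<and> x = c \<cdot>\<^sub>v y))"

end

theory Submission
  imports Defs
begin

text \<open>
  Write \<open>x = F z\<close> and \<open>y = F w\<close> with \<open>k\<close>-sparse \<open>z\<close> and \<open>w\<close>. It suffices to prove that the rank-one
  matrices of \<open>z\<close> and \<open>w\<close> agree, because they determine the vectors up to a unimodular factor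
  (\<open>cnj_products_eq_imp_unimodular_multiple\<close>). The entries of the difference of these matrices are
  grouped by cyclic diagonals: \<open>H m j\<close> is the difference of \<open>cnj (z j) * z (j + m)\<close> and
  \<open>cnj (w j) * w (j + m)\<close>, and its support lies over the set \<open>S\<close> of at most \<open>2 k\<close> indices where \<open>z\<close>
  or \<open>w\<close> does not vanish. The proof applies the uncertainty principle three times, each time to a
  vector for which the two supports together are too small, so that the vector must be zero.

  First, let \<open>\<gamma>\<close> be the unnormalised inverse Fourier transform of \<open>g\<close>, let \<open>R m l\<close> be the
  correlation at \<open>l\<close> of \<open>H m\<close> with the function \<open>s \<mapsto> \<gamma> s * cnj (\<gamma> (s + m))\<close>, and fix \<open>l\<close> in \<open>B\<close>.
  By \<open>cmod_inner_vec_tf_shift\<close> the Fourier transform of \<open>m \<mapsto> R m l\<close> is \<open>N\<close> times the difference of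
  the squared measurements at \<open>(p, l)\<close>. So it vanishes for \<open>p\<close> in \<open>A\<close>, whereas \<open>m \<mapsto> R m l\<close> lives on
  the differences of elements of \<open>S\<close>, of which there are at most \<open>(2 k)\<^sup>2 - 2 k + 1\<close>. Hence
  \<open>R m l = 0\<close> for all \<open>m\<close>.

  Secondly, fix \<open>m\<close>. Then \<open>l \<mapsto> R m l\<close> vanishes on \<open>B\<close>. Its Fourier transform is a product, by
  \<open>dft_correlation\<close>, and by \<open>dft_spec_corr\<close> one factor is, up to non-zero constants, the conjugate of
  the ambiguity function \<open>q \<mapsto> \<langle>g, g\<^sub>q\<^sub>,\<^sub>m\<rangle>\<close> of the window. That function has at most \<open>khat\<close> non-zero
  values, so \<open>R m\<close> vanishes identically, and so does the product.

  Thirdly, the other factor, the Fourier transform of \<open>H m\<close>, must therefore vanish wherever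
  the ambiguity function does not, that is, at no fewer than \<open>\<theta> + 2 k + 1\<close> points. As \<open>H m\<close> itself
  has at most \<open>2 k\<close> non-zero values, \<open>H m = 0\<close>.
\<close>

section \<open>Characters and periodic functions\<close>

definition chr :: "nat \<Rightarrow> int \<Rightarrow> complex" where
  "chr N t = root_of_unity N powi t"

text \<open>
  Functions on the residues modulo \<open>N\<close> are handled as \<open>N\<close>-periodic functions on the integers, so
  that index shifts are plain additions and only summation has to know about the modulus.
\<close>

definition periodic :: "nat \<Rightarrow> (int \<Rightarrow> complex) \<Rightarrow> bool" where
  "periodic N f \<longleftrightarrow> (\<forall>t. f (t mod int N) = f t)"

definition periodize :: "complex vec \<Rightarrow> int \<Rightarrow> complex" where
  "periodize x t = x $ nat (t mod int (dim_vec x))"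

lemma root_of_unity_nonzero [simp]: "root_of_unity N \<noteq> 0"
  by (simp add: root_of_unity_def)

lemma chr_0 [simp]: "chr N 0 = 1"
  by (simp add: chr_def)

lemma chr_add: "chr N (a + b) = chr N a * chr N b"
  by (simp add: chr_def power_int_add)

lemma chr_mult: "chr N (a * b) = chr N a powi b"
  by (simp add: chr_def power_int_mult)

lemma chr_cis: "chr N t = cis (of_int t * (2 * pi / N))"
  by (simp add: chr_def root_of_unity_def cis_conv_exp exp_power_int ac_simps)

lemma cnj_chr: "cnj (chr N t) = chr N (- t)"
  by (simp add: chr_cis cis_cnj)

lemma chr_eq_1_iff:
  assumes "N > 0"
  shows "chr N t = 1 \<longleftrightarrow> int N dvd t"
proof -
  have "chr N t = 1 \<longleftrightarrow> cos (of_int t * (2 * pi / N)) = 1"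
    by (auto simp: chr_cis complex_eq_iff intro: cos_one_sin_zero)
  also have "\<dots> \<longleftrightarrow> (\<exists>n::int. of_int t * (2 * pi / N) = of_int n * 2 * pi)"
    by (rule cos_one_2pi_int)
  also have "\<dots> \<longleftrightarrow> (\<exists>n::int. real_of_int t = real_of_int (n * int N))"
    using assms by (simp add: field_simps)
  also have "\<dots> \<longleftrightarrow> int N dvd t"
    unfolding of_int_eq_iff by (auto simp: dvd_def mult.commute)
  finally show ?thesis .
qed

lemma periodicD: "periodic N f \<Longrightarrow> f (t mod int N) = f t"
  by (simp add: periodic_def)

lemma periodic_mult:
  "periodic N f \<Longrightarrow> periodic N h \<Longrightarrow> periodic N (\<lambda>t. f t * h t)"
  by (simp add: periodic_def)

lemma periodic_cnj: "periodic N f \<Longrightarrow> periodic N (\<lambda>t. cnj (f t))"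
  by (simp add: periodic_def)

lemma periodic_shift:
  assumes "periodic N f"
  shows "periodic N (\<lambda>t. f (t + a))"
  unfolding periodic_def
  by (metis assms mod_add_left_eq periodicD)

lemma periodic_chr:
  assumes "N > 0"
  shows "periodic N (\<lambda>t. chr N (t * a))"
proof -
  have "chr N (t * a) = chr N (t mod int N * a)" for t
  proof -
    have "t * a = t mod int N * a + int N * (t div int N * a)"
      by (metis (no_types, opaque_lifting) distrib_right mod_mult_div_eq mult.assoc)
    moreover have "chr N (int N * (t div int N * a)) = 1"
      using assms by (simp add: chr_eq_1_iff)
    ultimately show ?thesis
      by (simp add: chr_add)
  qed
  then show ?thesis
    by (simp add: periodic_def)
qed

lemma periodic_periodize: "dim_vec x = N \<Longrightarrow> periodic N (periodize x)"
  by (simp add: periodic_def periodize_def)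

lemma periodize_nth: "i < dim_vec x \<Longrightarrow> periodize x (int i) = x $ i"
  by (simp add: periodize_def)

lemma sum_shift:
  assumes "periodic N f"
  shows "(\<Sum>n<N. f (int n + a)) = (\<Sum>n<N. f (int n))"
proof (cases "N = 0")
  case False
  have "(\<Sum>n<N. f (int n + a)) = (\<Sum>n<N. f (int (nat ((int n + a) mod int N))))"
    using False assms by (simp add: periodicD)
  also have "\<dots> = (\<Sum>n<N. f (int n))"
  proof (rule sum.reindex_bij_witness[where j = "\<lambda>n. nat ((int n + a) mod int N)"
        and i = "\<lambda>n. nat ((int n - a) mod int N)"])
    fix n assume n: "n \<in> {..<N}"
    show "nat ((int (nat ((int n + a) mod int N)) - a) mod int N) = n"
      using False n by (simp add: mod_simps)
    show "nat ((int (nat ((int n - a) mod int N)) + a) mod int N) = n"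
      using False n by (simp add: mod_simps)
    show "nat ((int n + a) mod int N) \<in> {..<N}" "nat ((int n - a) mod int N) \<in> {..<N}"
      using False by (simp_all add: nat_less_iff)
  qed simp
  finally show ?thesis .
qed simp

lemma sum_chr:
  assumes "N > 0"
  shows "(\<Sum>s<N. chr N (int s * t)) = (if int N dvd t then of_nat N else 0)"
proof (cases "int N dvd t")
  case True
  then have "chr N (int s * t) = 1" for s
    using assms by (simp add: chr_eq_1_iff)
  then show ?thesis using True by simp
next
  case False
  then have ne: "chr N t \<noteq> 1"
    using assms by (simp add: chr_eq_1_iff)
  have pow: "chr N (int s * t) = chr N t ^ s" for s
    by (metis chr_mult mult.commute power_int_of_nat)
  have "chr N t ^ N = 1"
    using assms by (metis chr_eq_1_iff dvd_triv_left pow)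
  then have "(\<Sum>s<N. chr N t ^ s) = 0"
    using ne by (simp add: geometric_sum)
  then show ?thesis using False pow by simp
qed

text \<open>
  Parseval's identity, which is orthogonality of the characters after multiplying out. The
  sequences \<open>a\<close> and \<open>b\<close> are arbitrary because each is evaluated only at \<open>0, \<dots>, N - 1\<close>.
\<close>

lemma parseval:
  assumes "N > 0"
  shows "(\<Sum>s<N. (\<Sum>n<N. a n * chr N (int s * int n)) *
      cnj (\<Sum>n<N. b n * chr N (int s * int n))) = of_nat N * (\<Sum>n<N. a n * cnj (b n))"
proof -
  have "(\<Sum>s<N. (\<Sum>n<N. a n * chr N (int s * int n)) * cnj (\<Sum>n<N. b n * chr N (int s * int n)))
      = (\<Sum>s<N. \<Sum>n<N. \<Sum>n'<N. a n * cnj (b n') * chr N (int s * (int n - int n')))"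
    by (simp add: sum_product cnj_chr chr_add[symmetric] algebra_simps)
  also have "\<dots> = (\<Sum>n<N. \<Sum>n'<N. a n * cnj (b n') * (\<Sum>s<N. chr N (int s * (int n - int n'))))"
    by (subst sum.swap, rule sum.cong, rule refl, subst sum.swap) (simp add: sum_distrib_left)
  also have "\<dots> = (\<Sum>n<N. \<Sum>n'<N. if n' = n then a n * cnj (b n') * of_nat N else 0)"
  proof (intro sum.cong refl)
    fix n n' assume "n \<in> {..<N}" "n' \<in> {..<N}"
    then have "int N dvd int n - int n' \<longleftrightarrow> n' = n"
      by (metis lessThan_iff mod_eq_dvd_iff mod_less of_nat_eq_iff zmod_int)
    then show "a n * cnj (b n') * (\<Sum>s<N. chr N (int s * (int n - int n'))) =
        (if n' = n then a n * cnj (b n') * of_nat N else 0)"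
      using assms by (simp add: sum_chr)
  qed
  also have "\<dots> = of_nat N * (\<Sum>n<N. a n * cnj (b n))"
    by (simp add: sum_distrib_left mult.commute)
  finally show ?thesis .
qed

text \<open>
  Grouping the double sum by the difference \<open>m\<close> of the two indices is what turns a squared measurement
  into a Fourier series in the translation parameter.
\<close>

lemma sum_times_cnj_sum:
  assumes "periodic N u"
  shows "(\<Sum>j<N. u (int j)) * cnj (\<Sum>j<N. u (int j)) =
    (\<Sum>m<N. \<Sum>j<N. u (int j) * cnj (u (int j + int m)))"
proof -
  have "(\<Sum>m<N. cnj (u (int j + int m))) = (\<Sum>m<N. cnj (u (int m)))" for j
    using sum_shift[OF periodic_cnj[OF assms], of "int j"] by (simp add: add.commute)
  then show ?thesis
    by (subst sum.swap) (simp add: sum_distrib_right flip: sum_distrib_left)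
qed

text \<open>
  The convolution theorem for correlations: substituting \<open>s = j + l\<close> splits \<open>chr N (- (l * q))\<close> into
  \<open>chr N (j * q)\<close> and \<open>chr N (- (s * q))\<close>.
\<close>

lemma dft_correlation:
  assumes "N > 0" and "periodic N G"
  shows "(\<Sum>l<N. (\<Sum>j<N. h j * G (int j + int l)) * chr N (- (int l * q))) =
    (\<Sum>j<N. h j * chr N (int j * q)) * (\<Sum>s<N. G (int s) * chr N (- (int s * q)))"
proof -
  have shift: "(\<Sum>l<N. G (int j + int l) * chr N (- (int l * q))) =
      chr N (int j * q) * (\<Sum>s<N. G (int s) * chr N (- (int s * q)))" for j
  proof -
    have per: "periodic N (\<lambda>s. G s * chr N (s * (- q)))"
      by (intro periodic_mult assms(2) periodic_chr assms(1))
    have "chr N (int j * q) * (\<Sum>s<N. G (int s) * chr N (- (int s * q))) =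
        chr N (int j * q) * (\<Sum>l<N. G (int l + int j) * chr N ((int l + int j) * (- q)))"
      using sum_shift[OF per, of "int j"] by simp
    also have "\<dots> = (\<Sum>l<N. G (int j + int l) *
        (chr N (int j * q + (int l + int j) * (- q))))"
      unfolding chr_add by (simp add: sum_distrib_left ac_simps)
    also have "\<dots> = (\<Sum>l<N. G (int j + int l) * chr N (- (int l * q)))"
      by (simp add: algebra_simps)
    finally show ?thesis ..
  qed
  have "(\<Sum>l<N. (\<Sum>j<N. h j * G (int j + int l)) * chr N (- (int l * q))) =
      (\<Sum>j<N. h j * (\<Sum>l<N. G (int j + int l) * chr N (- (int l * q))))"
    unfolding sum_distrib_right sum_distrib_left
    by (subst sum.swap) (simp add: mult.assoc)
  also have "\<dots> = (\<Sum>j<N. h j * chr N (int j * q)) * (\<Sum>s<N. G (int s) * chr N (- (int s * q)))"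
    by (simp add: shift sum_distrib_right mult.assoc)
  finally show ?thesis .
qed

lemma dft_vec_nth:
  "q < N \<Longrightarrow> dft (vec N f) $ q = (\<Sum>n<N. f n * chr N (- (int n * int q)))"
  by (simp add: dft_def chr_def atLeast0LessThan)

section \<open>Time-frequency measurements of Fourier-synthesised signals\<close>

text \<open>
  This is the Fourier transform of \<open>g\<close> at the frequency \<open>- s\<close>. The sign is the one produced by the
  conjugate of the Fourier basis in the antilinear argument of the scalar product.
\<close>

definition spec :: "complex vec \<Rightarrow> int \<Rightarrow> complex" where
  "spec g s = (\<Sum>n<dim_vec g. g $ n * chr (dim_vec g) (s * int n))"

lemma periodic_spec:
  assumes "N > 0" "dim_vec g = N"
  shows "periodic N (spec g)"
  unfolding periodic_def spec_def
  using periodicD[OF periodic_chr[OF assms(1)]] assms(2) by simp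

lemma inner_vec_tf_shift:
  assumes "dim_vec g = N"
  shows "inner_vec x (tf_shift g (p, l)) =
    (\<Sum>n<N. cnj (x $ n) * (chr N (int n * int l) * periodize g (int n - int p)))"
  using assms
  by (simp add: inner_vec_def tf_shift_def modulation_def translation_def periodize_def
      chr_def atLeast0LessThan mult.commute flip: power_int_of_nat)

lemma fourier_basis_mult_nth:
  assumes "z \<in> carrier_vec N" "n < N"
  shows "(fourier_basis N *\<^sub>v z) $ n = (\<Sum>j<N. chr N (- (int n * int j)) * z $ j) / sqrt N"
  using assms
  by (simp add: fourier_basis_def scalar_prod_def chr_def atLeast0LessThan sum_divide_distrib)

text \<open>
  On the Fourier side translation by \<open>p\<close> becomes a modulation and modulation by \<open>l\<close> a translation.
  The measurement is therefore a trigonometric sum in \<open>p\<close> whose frequencies \<open>j + l\<close> come from the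
  support of \<open>z\<close>.
\<close>

lemma inner_vec_fourier_basis_tf_shift:
  assumes N: "N > 0" and g: "g \<in> carrier_vec N" and z: "z \<in> carrier_vec N"
  shows "sqrt N * inner_vec (fourier_basis N *\<^sub>v z) (tf_shift g (p, l)) =
    (\<Sum>j<N. cnj (z $ j) * (spec g (int j + int l) * chr N ((int j + int l) * int p)))"
proof -
  have dim: "dim_vec g = N" using g by simp
  have freq: "(\<Sum>n<N. chr N (int n * t) * periodize g (int n - int p)) =
      spec g t * chr N (t * int p)" for t
  proof -
    have per: "periodic N (\<lambda>n. chr N (n * t) * periodize g (n + (- int p)))"
      by (intro periodic_mult periodic_chr periodic_shift[OF periodic_periodize] N dim)
    have "(\<Sum>n<N. chr N (int n * t) * periodize g (int n - int p)) =
        (\<Sum>n<N. chr N ((int n + int p) * t) * periodize g (int n))"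
      using sum_shift[OF per, of "int p"] by simp
    also have "\<dots> = spec g t * chr N (t * int p)"
      using dim by (simp add: spec_def sum_distrib_right periodize_nth distrib_left distrib_right
          chr_add sum_distrib_left ac_simps)
    finally show ?thesis .
  qed
  have "sqrt N * inner_vec (fourier_basis N *\<^sub>v z) (tf_shift g (p, l)) =
      (\<Sum>n<N. (\<Sum>j<N. chr N (int n * int j) * cnj (z $ j)) *
        (chr N (int n * int l) * periodize g (int n - int p)))"
    using N z by (simp add: inner_vec_tf_shift[OF dim] fourier_basis_mult_nth sum_distrib_left
        cnj_chr)
  also have "\<dots> = (\<Sum>j<N. cnj (z $ j) *
      (\<Sum>n<N. chr N (int n * (int j + int l)) * periodize g (int n - int p)))"
    unfolding sum_distrib_right sum_distrib_left
    by (subst sum.swap) (simp add: distrib_left chr_add ac_simps)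
  finally show ?thesis
    by (simp add: freq)
qed

definition autocorr :: "complex vec \<Rightarrow> int \<Rightarrow> int \<Rightarrow> complex" where
  "autocorr z m j = cnj (periodize z j) * periodize z (j + m)"

definition spec_corr :: "complex vec \<Rightarrow> int \<Rightarrow> int \<Rightarrow> complex" where
  "spec_corr g m s = spec g s * cnj (spec g (s + m))"

text \<open>
  The squared measurements are, for fixed \<open>l\<close>, the Fourier transform in \<open>m\<close> of the correlation of the
  \<open>m\<close>-th diagonals of \<open>z\<close> and of the spectrum of \<open>g\<close>: the phases of the summands \<open>j\<close> and \<open>j + m\<close>
  combine to \<open>chr N (- (m * p))\<close>, which depends neither on \<open>j\<close> nor on \<open>l\<close>.
\<close>

lemma cmod_inner_vec_tf_shift:
  assumes N: "N > 0" and g: "g \<in> carrier_vec N" and z: "z \<in> carrier_vec N"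
  shows "of_nat N * complex_of_real ((cmod (inner_vec (fourier_basis N *\<^sub>v z) (tf_shift g (p, l))))\<^sup>2) =
    (\<Sum>m<N. (\<Sum>j<N. autocorr z (int m) (int j) * spec_corr g (int m) (int j + int l))
      * chr N (- (int m * int p)))"
    (is "_ * complex_of_real ((cmod ?I)\<^sup>2) = _")
proof -
  have dim: "dim_vec g = N" "dim_vec z = N" using g z by simp_all
  define u where "u j = cnj (periodize z j) *
    (spec g (j + int l) * chr N ((j + int l) * int p))" for j
  have per: "periodic N u"
    unfolding u_def
    by (intro periodic_mult periodic_cnj periodic_periodize dim
        periodic_shift[OF periodic_spec] periodic_shift[OF periodic_chr] N)
  have u: "sqrt N * ?I = (\<Sum>j<N. u (int j))"
    using dim by (simp add: inner_vec_fourier_basis_tf_shift[OF N g z] u_def periodize_nth)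
  have "of_nat N * complex_of_real ((cmod ?I)\<^sup>2) = complex_of_real ((cmod (sqrt N * ?I))\<^sup>2)"
    by (simp add: norm_mult power_mult_distrib)
  also have "\<dots> = (\<Sum>j<N. u (int j)) * cnj (\<Sum>j<N. u (int j))"
    unfolding u complex_norm_square ..
  also have "\<dots> = (\<Sum>m<N. \<Sum>j<N. u (int j) * cnj (u (int j + int m)))"
    by (rule sum_times_cnj_sum[OF per])
  also have "\<dots> = (\<Sum>m<N. (\<Sum>j<N. autocorr z (int m) (int j) * spec_corr g (int m) (int j + int l))
      * chr N (- (int m * int p)))"
  proof -
    have "u (int j) * cnj (u (int j + int m)) =
        autocorr z (int m) (int j) * spec_corr g (int m) (int j + int l) *
        chr N (- (int m * int p))" for j m
    proof -
      have c: "chr N ((int j + int l) * int p) * chr N (- ((int j + int m + int l) * int p)) =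
          chr N (- (int m * int p))"
        unfolding chr_add[symmetric] by (simp add: algebra_simps)
      show ?thesis
        unfolding c[symmetric]
        by (simp add: u_def autocorr_def spec_corr_def cnj_chr ac_simps)
    qed
    then show ?thesis
      by (simp add: sum_distrib_right)
  qed
  finally show ?thesis .
qed

text \<open>
  This brings in the hypotheses on the window. A modulation of the spectrum is a translation of \<open>g\<close>,
  and a translation of the spectrum a modulation of \<open>g\<close>, so Parseval's identity returns an ambiguity
  function of \<open>g\<close>. The shift \<open>n \<mapsto> n + q\<close> needed to match it with \<open>inner_vec g (tf_shift g (q, m))\<close>
  costs the phase \<open>chr N (m * q)\<close>.
\<close>

lemma dft_spec_corr:
  assumes N: "N > 0" and g: "g \<in> carrier_vec N"
  shows "(\<Sum>s<N. spec_corr g (int m) (int s) * chr N (- (int s * int q))) =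
    of_nat N * chr N (int m * int q) * cnj (inner_vec g (tf_shift g (q, m)))"
proof -
  have dim: "dim_vec g = N" using g by simp
  have shifted: "spec g s * chr N (- (s * int q)) =
      (\<Sum>n<N. periodize g (int n + int q) * chr N (s * int n))" for s
  proof -
    have per: "periodic N (\<lambda>n. periodize g n * chr N ((n + - int q) * s))"
      by (intro periodic_mult periodic_shift[OF periodic_chr] periodic_periodize N dim)
    have "spec g s * chr N (- (s * int q)) =
        (\<Sum>n<N. periodize g (int n) * chr N ((int n + - int q) * s))"
      unfolding spec_def sum_distrib_right dim
      by (intro sum.cong refl)
        (simp add: dim periodize_nth algebra_simps flip: chr_add)
    also have "\<dots> = (\<Sum>n<N. periodize g (int n + int q) * chr N (s * int n))"
      using sum_shift[OF per, of "int q"] by (simp add: mult.commute)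
    finally show ?thesis .
  qed
  have modulated: "spec g (s + int m) =
      (\<Sum>n<N. (g $ n * chr N (int m * int n)) * chr N (s * int n))" for s
    by (simp add: spec_def dim distrib_left distrib_right chr_add ac_simps)
  have "(\<Sum>s<N. spec_corr g (int m) (int s) * chr N (- (int s * int q))) =
      (\<Sum>s<N. (spec g (int s) * chr N (- (int s * int q))) * cnj (spec g (int s + int m)))"
    by (simp add: spec_corr_def ac_simps)
  also have "\<dots> = of_nat N *
      (\<Sum>n<N. periodize g (int n + int q) * cnj (g $ n * chr N (int m * int n)))"
    unfolding shifted modulated by (rule parseval[OF N])
  also have "(\<Sum>n<N. periodize g (int n + int q) * cnj (g $ n * chr N (int m * int n))) =
      chr N (int m * int q) * cnj (inner_vec g (tf_shift g (q, m)))"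
  proof -
    have per: "periodic N (\<lambda>n. periodize g n *
        (chr N (n * (- int m)) * cnj (periodize g (n + - int q))))"
      by (intro periodic_mult periodic_cnj periodic_chr periodic_shift[OF periodic_periodize]
          periodic_periodize N dim)
    have "chr N (int m * int q) * cnj (inner_vec g (tf_shift g (q, m))) =
        chr N (int m * int q) * (\<Sum>n<N. periodize g (int n) *
          (chr N (int n * (- int m)) * cnj (periodize g (int n + - int q))))"
      by (simp add: inner_vec_tf_shift[OF dim] cnj_chr periodize_nth dim)
    also have "\<dots> = chr N (int m * int q) * (\<Sum>n<N. periodize g (int n + int q) *
        (chr N ((int n + int q) * (- int m)) * cnj (periodize g (int n))))"
      using sum_shift[OF per, of "int q"] by simp
    also have "\<dots> = (\<Sum>n<N. periodize g (int n + int q) *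
        (chr N (int m * int q + (int n + int q) * (- int m)) * cnj (periodize g (int n))))"
      unfolding chr_add by (simp add: sum_distrib_left ac_simps)
    also have "\<dots> = (\<Sum>n<N. periodize g (int n + int q) * cnj (g $ n * chr N (int m * int n)))"
      by (intro sum.cong refl) (simp add: cnj_chr periodize_nth dim algebra_simps)
    finally show ?thesis ..
  qed
  finally show ?thesis by simp
qed

section \<open>Supports\<close>

lemma norm0_vec_le_card:
  assumes "finite T" "\<And>i. i < N \<Longrightarrow> f i \<noteq> 0 \<Longrightarrow> i \<in> T"
  shows "norm0 (vec N f) \<le> card T"
  unfolding norm0_def
  by (rule card_mono) (use assms in auto)

lemma norm0_zero_on:
  assumes "T \<subseteq> {0..<dim_vec v}" "\<And>i. i \<in> T \<Longrightarrow> v $ i = 0"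
  shows "norm0 v + card T \<le> dim_vec v"
proof -
  have fin: "finite T" using assms(1) finite_subset by blast
  have "norm0 v + card T = card ({i. i < dim_vec v \<and> v $ i \<noteq> 0} \<union> T)"
    unfolding norm0_def by (rule card_Un_disjoint[symmetric]) (use assms fin in auto)
  also have "\<dots> \<le> card {0..<dim_vec v}"
    by (rule card_mono) (use assms in auto)
  finally show ?thesis by simp
qed

lemma dim_dft [simp]: "dim_vec (dft f) = dim_vec f"
  by (simp add: dft_def)

text \<open>
  All pairs on the diagonal of \<open>S \<times> S\<close> share the difference \<open>0\<close>, which saves \<open>card S - 1\<close> of the
  \<open>card S * card S\<close> values.
\<close>

lemma card_differences_le:
  fixes S :: "nat set"
  assumes "finite S" "card S \<le> K" "K \<ge> 1"
  shows "card ((\<lambda>(a, b). nat ((int b - int a) mod int N)) ` (S \<times> S)) \<le> K * K - K + 1"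
    (is "card (?d ` _) \<le> _")
proof -
  have sub: "?d ` (S \<times> S) \<subseteq> insert 0 (?d ` (S \<times> S - Id_on S))"
    by auto
  have "card (?d ` (S \<times> S)) \<le> Suc (card (?d ` (S \<times> S - Id_on S)))"
    using assms(1) by (intro order_trans[OF card_mono[OF _ sub] card_insert_le_m1]) simp_all
  also have "card (?d ` (S \<times> S - Id_on S)) \<le> card (S \<times> S - Id_on S)"
    using assms(1) by (intro card_image_le) simp
  also have "card (S \<times> S - Id_on S) = card S * card S - card S"
  proof -
    have "Id_on S = (\<lambda>a. (a, a)) ` S" by auto
    then have "card (Id_on S) = card S" "finite (Id_on S)"
      using assms(1) by (simp_all add: card_image inj_on_def)
    moreover have "Id_on S \<subseteq> S \<times> S" by auto
    ultimately show ?thesis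
      by (simp add: card_Diff_subset card_cartesian_product)
  qed
  also have "\<dots> = card S * (card S - 1)" by (simp add: diff_mult_distrib2)
  also have "\<dots> \<le> K * (K - 1)" using assms by (intro mult_le_mono) auto
  also have "\<dots> = K * K - K" by (simp add: diff_mult_distrib2)
  finally show ?thesis by simp
qed

text \<open>
  The diagonal entries give equal moduli. If \<open>z\<close> has a non-zero entry \<open>i\<close>, dividing the \<open>i\<close>-th row by
  \<open>cnj (z $ i)\<close> recovers \<open>z\<close> from \<open>w\<close> with the factor \<open>cnj (w $ i) / cnj (z $ i)\<close>.
\<close>

lemma cnj_products_eq_imp_unimodular_multiple:
  assumes z: "z \<in> carrier_vec N" and w: "w \<in> carrier_vec N"
    and eq: "\<And>i j. i < N \<Longrightarrow> j < N \<Longrightarrow> cnj (z $ i) * z $ j = cnj (w $ i) * w $ j"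
  shows "\<exists>c. cmod c = 1 \<and> z = c \<cdot>\<^sub>v w"
proof -
  have mod_eq: "cmod (z $ i) = cmod (w $ i)" if "i < N" for i
  proof -
    have "complex_of_real ((cmod (z $ i))\<^sup>2) = complex_of_real ((cmod (w $ i))\<^sup>2)"
      unfolding complex_norm_square using eq[OF that that] by (simp add: mult.commute)
    then have "(cmod (z $ i))\<^sup>2 = (cmod (w $ i))\<^sup>2"
      unfolding of_real_eq_iff .
    then show ?thesis by (simp add: power2_eq_iff_nonneg)
  qed
  show ?thesis
  proof (cases "\<exists>i<N. z $ i \<noteq> 0")
    case True
    then obtain i where i: "i < N" "z $ i \<noteq> 0" by blast
    let ?c = "cnj (w $ i) / cnj (z $ i)"
    have "cmod ?c = 1" using mod_eq[OF i(1)] i(2) by (auto simp: norm_divide)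
    moreover have "z = ?c \<cdot>\<^sub>v w"
      by (rule eq_vecI) (use z w i eq in \<open>auto simp: field_simps\<close>)
    ultimately show ?thesis by blast
  next
    case False
    then have "z = 1 \<cdot>\<^sub>v w"
      using mod_eq by (intro eq_vecI) (use z w in auto)
    then show ?thesis using norm_one by blast
  qed
qed

section \<open>Phase retrieval\<close>

theorem theorem3p4:
  fixes N k khat :: nat and \<theta> :: real and g :: "complex vec" and A B :: "nat set"
  assumes "N \<ge> 1"
    and "\<And>f. f \<in> carrier_vec N \<Longrightarrow> f \<noteq> 0\<^sub>v N \<Longrightarrow>
           real (norm0 f) + real (norm0 (dft f)) \<ge> real N - \<theta>"
    and "g \<in> carrier_vec N"
    and "k \<ge> 1" and "khat \<ge> 1"
    and "\<And>l. l < N \<Longrightarrow>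
           \<theta> + 2 * real k + 1 \<le> real (norm0 (vec N (\<lambda>p. inner_vec g (tf_shift g (p, l)))))"
    and "\<And>l. l < N \<Longrightarrow> norm0 (vec N (\<lambda>p. inner_vec g (tf_shift g (p, l)))) \<le> khat"
    and "A \<subseteq> {0..<N}" and "B \<subseteq> {0..<N}"
    and "real (card A) \<ge> \<theta> + (2 * real k)^2 - 2 * real k + 2"
    and "real (card B) \<ge> \<theta> + real khat + 1"
  shows "allows_fourier_sparse_phase_retrieval N k (A \<times> B) (tf_shift g)"
  unfolding allows_fourier_sparse_phase_retrieval_def
proof (intro allI impI)
  fix x y
  assume "fourier_sparse N k x" and "fourier_sparse N k y"
    and meas: "\<forall>i\<in>A \<times> B. cmod (inner_vec x (tf_shift g i)) = cmod (inner_vec y (tf_shift g i))"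
  then obtain z w where z: "z \<in> carrier_vec N" "norm0 z \<le> k" "x = fourier_basis N *\<^sub>v z"
    and w: "w \<in> carrier_vec N" "norm0 w \<le> k" "y = fourier_basis N *\<^sub>v w"
    unfolding fourier_sparse_def by blast
  have N: "N > 0" using assms(1) by simp
  have dim: "dim_vec g = N" "dim_vec z = N" "dim_vec w = N" using assms(3) z w by simp_all
  have vanish: "f i = 0"
    if "real (norm0 (vec N f)) + real (norm0 (dft (vec N f))) < real N - \<theta>" "i < N" for f i
  proof -
    have "vec N f = 0\<^sub>v N"
      using assms(2)[of "vec N f"] that(1) by fastforce
    then show ?thesis using that(2) by (metis index_vec index_zero_vec(1))
  qed
  define S where "S = {i. i < N \<and> z $ i \<noteq> 0} \<union> {i. i < N \<and> w $ i \<noteq> 0}"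
  have S: "finite S" "card S \<le> 2 * k"
    using card_Un_le[of "{i. i < N \<and> z $ i \<noteq> 0}" "{i. i < N \<and> w $ i \<noteq> 0}"] z(2) w(2) dim
    by (simp_all add: S_def norm0_def)
  define H where "H m j = autocorr z m j - autocorr w m j" for m j
  have H_supp: "nat (j mod int N) \<in> S \<and> nat ((j + m) mod int N) \<in> S" if "H m j \<noteq> 0" for m j
    using that N by (auto simp: H_def S_def autocorr_def periodize_def dim nat_less_iff)
  define R where "R m l = (\<Sum>j<N. H (int m) (int j) * spec_corr g (int m) (int j + int l))" for m l
  have R_B: "R m l = 0" if "m < N" "l \<in> B" for m l
  proof -
    \<comment> \<open>Uncertainty in \<open>m\<close>, whose dual variable is the translation parameter \<open>p\<close>.\<close>
    let ?f = "\<lambda>m. R m l" and ?d = "\<lambda>(a, b). nat ((int b - int a) mod int N)"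
    have dft_f: "dft (vec N ?f) $ p = of_nat N *
        complex_of_real ((cmod (inner_vec x (tf_shift g (p, l))))\<^sup>2) - of_nat N *
        complex_of_real ((cmod (inner_vec y (tf_shift g (p, l))))\<^sup>2)" if "p < N" for p
      unfolding z(3) w(3) cmod_inner_vec_tf_shift[OF N assms(3) z(1)]
        cmod_inner_vec_tf_shift[OF N assms(3) w(1)] dft_vec_nth[OF that]
      by (simp add: R_def H_def left_diff_distrib sum_subtractf)
    have "norm0 (dft (vec N ?f)) + card A \<le> dim_vec (dft (vec N ?f))"
    proof (rule norm0_zero_on)
      show "dft (vec N ?f) $ p = 0" if "p \<in> A" for p
      proof -
        have "p < N" using that assms(8) by auto
        moreover have "cmod (inner_vec x (tf_shift g (p, l))) = cmod (inner_vec y (tf_shift g (p, l)))"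
          using meas that \<open>l \<in> B\<close> by blast
        ultimately show ?thesis by (simp only: dft_f diff_self)
      qed
    qed (use assms(8) in simp)
    moreover have "norm0 (vec N ?f) \<le> card (?d ` (S \<times> S))"
    proof (rule norm0_vec_le_card)
      fix m assume m: "m < N" "R m l \<noteq> 0"
      then obtain j where "j < N" "H (int m) (int j) \<noteq> 0"
        unfolding R_def by (auto elim!: sum.not_neutral_contains_not_neutral)
      moreover define j' where "j' = nat ((int j + int m) mod int N)"
      ultimately have "j \<in> S" "j' \<in> S" using H_supp by force+
      moreover have "m = nat ((int j' - int j) mod int N)"
        using m N by (simp add: j'_def mod_simps)
      ultimately show "m \<in> ?d ` (S \<times> S)" by force
    qed (use S in simp)
    moreover have "card (?d ` (S \<times> S)) \<le> 2 * k * (2 * k) - 2 * k + 1"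
      using card_differences_le[OF S] assms(4) by simp
    moreover have "real (2 * k * (2 * k) - 2 * k + 1) = (2 * real k)\<^sup>2 - 2 * real k + 1"
    proof -
      have "2 * k \<le> 2 * k * (2 * k)" using assms(4) by simp
      then show ?thesis by (simp add: of_nat_diff power2_eq_square)
    qed
    moreover have "dim_vec (dft (vec N ?f)) = N" by simp
    ultimately have "real (norm0 (vec N ?f)) + real (norm0 (dft (vec N ?f))) < real N - \<theta>"
      using assms(10) by linarith
    then show ?thesis using vanish[of ?f m] that by simp
  qed
  have H0: "H (int m) (int j) = 0" if "m < N" "j < N" for m j
  proof -
    let ?c = "vec N (\<lambda>p. inner_vec g (tf_shift g (p, m)))"
    let ?h = "\<lambda>q. \<Sum>j<N. H (int m) (int j) * chr N (int j * int q)"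
    have per: "periodic N (spec_corr g (int m))"
      unfolding spec_corr_def
      by (intro periodic_mult periodic_cnj periodic_shift periodic_spec N dim)
    \<comment> \<open>Uncertainty in \<open>l\<close>, whose dual variable \<open>q\<close> is the argument of the ambiguity function.\<close>
    have dft_R: "dft (vec N (R m)) $ q =
        ?h q * (of_nat N * chr N (int m * int q) * cnj (?c $ q))" if "q < N" for q
      using that
      by (simp add: dft_vec_nth R_def dft_correlation[OF N per] dft_spec_corr[OF N assms(3)])
    have "norm0 (dft (vec N (R m))) \<le> norm0 ?c"
      unfolding norm0_def by (rule card_mono) (auto simp: dft_R)
    moreover have "norm0 (vec N (R m)) + card B \<le> dim_vec (vec N (R m))"
      by (rule norm0_zero_on) (use assms(9) R_B[OF \<open>m < N\<close>] in auto)
    ultimately have "real (norm0 (vec N (R m))) + real (norm0 (dft (vec N (R m)))) < real N - \<theta>"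
      using assms(7)[OF \<open>m < N\<close>] assms(11) by simp
    then have "R m l = 0" if "l < N" for l
      using vanish that by blast
    then have "dft (vec N (R m)) $ q = 0" if "q < N" for q
      using that by (simp add: dft_vec_nth)
    moreover have "chr N t \<noteq> 0" for t by (simp add: chr_def)
    ultimately have h0: "?h q = 0" if "q < N" "?c $ q \<noteq> 0" for q
      using that dft_R N by auto
    \<comment> \<open>Uncertainty in \<open>j\<close>. Conjugation turns \<open>?h\<close>, which has the opposite sign in the exponent, into
        a discrete Fourier transform.\<close>
    let ?f = "\<lambda>j. cnj (H (int m) (int j))"
    have dft_f: "dft (vec N ?f) $ q = cnj (?h q)" if "q < N" for q
      using that by (simp add: dft_vec_nth cnj_chr)
    have dft_f_0: "dft (vec N ?f) $ q = 0" if "q < N" "?c $ q \<noteq> 0" for q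
      using h0[OF that] dft_f[OF that(1)] by (simp only: complex_cnj_zero)
    have "norm0 (dft (vec N ?f)) + norm0 ?c \<le> dim_vec (dft (vec N ?f))"
      unfolding norm0_def[of ?c]
      by (rule norm0_zero_on) (use dft_f_0 in auto)
    moreover have "norm0 (vec N ?f) \<le> 2 * k"
      by (rule order_trans[OF norm0_vec_le_card[OF S(1)] S(2)]) (use H_supp in force)
    ultimately have "real (norm0 (vec N ?f)) + real (norm0 (dft (vec N ?f))) < real N - \<theta>"
      using assms(6)[OF \<open>m < N\<close>] by simp
    then show ?thesis using vanish[of ?f j] that by simp
  qed
  have "cnj (z $ i) * z $ j = cnj (w $ i) * w $ j" if "i < N" "j < N" for i j
  proof -
    define m where "m = nat ((int j - int i) mod int N)"
    have m: "m < N" "(int i + int m) mod int N = int j"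
      using N that by (simp_all add: m_def nat_less_iff mod_simps)
    show ?thesis
      using H0[OF m(1) that(1)] that m
      by (simp add: H_def autocorr_def periodize_def dim)
  qed
  then obtain c where "cmod c = 1" "z = c \<cdot>\<^sub>v w"
    using cnj_products_eq_imp_unimodular_multiple[OF z(1) w(1)] by blast
  moreover have "fourier_basis N \<in> carrier_mat N N" by (simp add: fourier_basis_def)
  ultimately show "\<exists>c. cmod c = 1 \<and> x = c \<cdot>\<^sub>v y"
    using z(3) w by (metis mult_mat_vec)
qed

end
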